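(* Let $(\boldsymbol{X},\boldsymbol{T})$ and $(\boldsymbol{Y},\boldsymbol{R})$ be nonautonomous dynamical systems, let $\boldsymbol{g}\in\boldsymbol{C}(\boldsymbol{Y},\mathbb{R})$ be equicontinuous and $Z\subset X_0$. Suppose that $P\in\{\underline{Q},\overline{Q},\underline{P},\overline{P},P^{\mathrm{B}},P^{\mathrm{P}}\}$. (1) If $\boldsymbol{\pi}$ is an equisemiconjugacy from $(\boldsymbol{X},\boldsymbol{T})$ to $(\boldsymbol{Y},\boldsymbol{R})$, then $$P(\boldsymbol{T},\boldsymbol{\pi}^*\boldsymbol{g},Z)\ge P(\boldsymbol{R},\boldsymbol{g},\pi_0(Z)).$$ (2) If $\boldsymbol{\pi}$ is an equiconjugacy from $(\boldsymbol{X},\boldsymbol{T})$ to $(\boldsymbol{Y},\boldsymbol{R})$, then $$P(\boldsymbol{T},\boldsymbol{\pi}^*\boldsymbol{g},Z)=P(\boldsymbol{R},\boldsymbol{g},\pi_0(Z)).$$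
   Context: A nonautonomous dynamical system (NDS) $(\boldsymbol{X},\boldsymbol{T})$ consists of a sequence $\boldsymbol{X}=\{X_k\}_{k=0}^\infty$ of compact metric spaces $(X_k,d_{X_k})$ and a sequence $\boldsymbol{T}=\{T_k\}_{k=0}^\infty$ of continuous maps $T_k:X_k\to X_{k+1}$. Write $\boldsymbol{T}^0=\mathrm{id}_{X_0}$ and $\boldsymbol{T}^j=T_{j-1}\circ\cdots\circ T_0:X_0\to X_j$. For $n\ge 1$ the $n$-th Bowen metric on $X_0$ is $d_n^{\boldsymbol{T}}(x,y)=\max_{0\le j\le n-1}d_{X_j}(\boldsymbol{T}^jx,\boldsymbol{T}^jy)$; $B_n^{\boldsymbol{T}}(x,\varepsilon)$ and $\overline{B}_n^{\boldsymbol{T}}(x,\varepsilon)$ are the open ($<\varepsilon$) and closed ($\le\varepsilon$) balls of this metric. $\boldsymbol{C}(\boldsymbol{X},\mathbb{R})=\prod_{k\ge 0}C(X_k,\mathbb{R})$ is the set of sequences $\boldsymbol{f}=\{f_k\}_{k=0}^\infty$ of continuous functions $f_k:X_k\to\mathbb{R}$, and $S_n^{\boldsymbol{T}}\boldsymbol{f}=\sum_{j=0}^{n-1}f_j\circ\boldsymbol{T}^j$. $\boldsymbol{f}$ is equicontinuous if for every $\varepsilon>0$ there is $\delta>0$ such that for all $k\ge0$ and $x,y\in X_k$ with $d_{X_k}(x,y)<\delta$ we have $|f_k(x)-f_k(y)|<\varepsilon$. Conjugacies. A semiconjugacy from $(\boldsymbol{X},\boldsymbol{T})$ to $(\boldsymbol{Y},\boldsymbol{R})$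 is a sequence $\boldsymbol{\pi}=\{\pi_k\}_{k=0}^\infty$ of surjective continuous maps $\pi_k:X_k\to Y_k$ with $R_k\circ\pi_k=\pi_{k+1}\circ T_k$ for all $k\ge0$; it is a conjugacy if all $\pi_k$ are homeomorphisms. It is an equisemiconjugacy if it is a semiconjugacy that is equicontinuous: for every $\varepsilon>0$ there is $\delta>0$ such that for all $k\ge0$ and all $x',x''\in X_k$ with $d_{X_k}(x',x'')<\delta$ one has $d_{Y_k}(\pi_kx',\pi_kx'')<\varepsilon$. A conjugacy is an equiconjugacy if both $\boldsymbol{\pi}$ and $\boldsymbol{\pi}^{-1}=\{\pi_k^{-1}\}$ are equicontinuous. $\boldsymbol{\pi}^*\boldsymbol{g}=\{g_k\circ\pi_k\}_{k=0}^\infty\in\boldsymbol{C}(\boldsymbol{X},\mathbb{R})$. Spanning and separated pressures. For $Z\subset X_0$, $n\ge1$, $\varepsilon>0$: $F\subset X_0$ is $(n,\varepsilon)$-spanning for $Z$ if for every $x\in Z$ there is $y\in F$ with $d_n^{\boldsymbol{T}}(x,y)\le\varepsilon$; $E\subset Z$ is $(n,\varepsilon)$-separated for $Z$ if $d_n^{\boldsymbol{T}}(x,y)>\varepsilon$ for all distinct $x,y\in E$. Let $Q_n(\boldsymbol{T},\boldsymbol{f},Z,\varepsilon)=\inf_F\sum_{x\in F}e^{S_n^{\boldsymbol{T}}\boldsymbol{f}(x)}$ over $(n,\varepsilon)$-spanning sets $F$ for $Z$ and $P_n(\boldsymbol{T},\boldsymbol{f},Z,\varepsilon)=\sup_E\sum_{x\in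 E}e^{S_n^{\boldsymbol{T}}\boldsymbol{f}(x)}$ over $(n,\varepsilon)$-separated sets $E$ for $Z$. Let $\underline{Q}(\boldsymbol{T},\boldsymbol{f},Z,\varepsilon)$, $\overline{Q}(\boldsymbol{T},\boldsymbol{f},Z,\varepsilon)$ be the $\liminf$, $\limsup$ as $n\to\infty$ of $\frac1n\log Q_n(\boldsymbol{T},\boldsymbol{f},Z,\varepsilon)$, and $\underline{P}(\boldsymbol{T},\boldsymbol{f},Z,\varepsilon)$, $\overline{P}(\boldsymbol{T},\boldsymbol{f},Z,\varepsilon)$ those of $\frac1n\log P_n(\boldsymbol{T},\boldsymbol{f},Z,\varepsilon)$ ($\log 0=-\infty$). Then $\underline{Q},\overline{Q},\underline{P},\overline{P}(\boldsymbol{T},\boldsymbol{f},Z)$ are the (monotone) limits of these as $\varepsilon\to0$. Bowen pressure. For $s\in\mathbb{R}$, $N>0$, $\varepsilon>0$ let $\mathscr{R}^s_{N,\varepsilon}(\boldsymbol{T},\boldsymbol{f},Z)=\inf\sum_i\exp(-n_is+S_{n_i}^{\boldsymbol{T}}\boldsymbol{f}(x_i))$ over all countable families $\{B_{n_i}^{\boldsymbol{T}}(x_i,\varepsilon)\}_i$ with $n_i\ge N$, $x_i\in X_0$, covering $Z$. Put $\mathscr{R}^s_\varepsilon=\lim_{N\to\infty}\mathscr{R}^s_{N,\varepsilon}$, $P^{\mathrm{B}}(\boldsymbol{T},\boldsymbol{f},Z,\varepsilon)=\inf\{s:\mathscr{R}^s_\varepsilon(\boldsymbol{T},\boldsymbol{f},Z)=0\}=\sup\{s:\mathscr{R}^s_\varepsilon(\boldsymbol{T},\boldsymbol{f},Z)=+\infty\}$,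 and $P^{\mathrm{B}}(\boldsymbol{T},\boldsymbol{f},Z)=\lim_{\varepsilon\to0}P^{\mathrm{B}}(\boldsymbol{T},\boldsymbol{f},Z,\varepsilon)$. Packing pressure. Let $\mathscr{P}^s_{N,\varepsilon}(\boldsymbol{T},\boldsymbol{f},Z)=\sup\sum_i\exp(-n_is+S_{n_i}^{\boldsymbol{T}}\boldsymbol{f}(x_i))$ over all (at most) countable pairwise disjoint families $\{\overline{B}_{n_i}^{\boldsymbol{T}}(x_i,\varepsilon)\}_i$ with $x_i\in Z$, $n_i\ge N$. Put $\mathscr{P}^s_{\infty,\varepsilon}=\lim_{N\to\infty}\mathscr{P}^s_{N,\varepsilon}$, $\mathscr{P}^s_\varepsilon(\boldsymbol{T},\boldsymbol{f},Z)=\inf\{\sum_{i=1}^\infty\mathscr{P}^s_{\infty,\varepsilon}(\boldsymbol{T},\boldsymbol{f},Z_i):\bigcup_iZ_i\supset Z\}$, $P^{\mathrm{P}}(\boldsymbol{T},\boldsymbol{f},Z,\varepsilon)=\inf\{s:\mathscr{P}^s_\varepsilon(\boldsymbol{T},\boldsymbol{f},Z)=0\}=\sup\{s:\mathscr{P}^s_\varepsilon(\boldsymbol{T},\boldsymbol{f},Z)=+\infty\}$, and $P^{\mathrm{P}}(\boldsymbol{T},\boldsymbol{f},Z)=\lim_{\varepsilon\to0}P^{\mathrm{P}}(\boldsymbol{T},\boldsymbol{f},Z,\varepsilon)$. All pressures take values in $\mathbb{R}\cup\{\pm\infty\}$. *)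

theory Defs
  imports "HOL-Analysis.Analysis"
begin

text \<open>
  The spaces of a nonautonomous system are a sequence of \<open>'a metric\<close> values sharing one carrier
  type \<open>'a\<close>, which is arbitrary; the spaces themselves may be different subsets of \<open>'a\<close> with
  unrelated metrics.  Any sequence of metric spaces has this form, with \<open>'a\<close> the
  disjoint union of the spaces.  Maps are total functions on \<open>'a\<close>, of which only the values on
  the carriers matter.
\<close>

definition nds :: "(nat \<Rightarrow> 'a metric) \<Rightarrow> (nat \<Rightarrow> 'a \<Rightarrow> 'a) \<Rightarrow> bool" where
  "nds X T \<longleftrightarrow>
     (\<forall>k. compact_space (mtopology_of (X k))) \<and>
     (\<forall>k. continuous_map (mtopology_of (X k)) (mtopology_of (X (Suc k))) (T k))"

primrec orbit_map :: "(nat \<Rightarrow> 'a \<Rightarrow> 'a) \<Rightarrow> nat \<Rightarrow> 'a \<Rightarrow> 'a" where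
  "orbit_map T 0 = id"
| "orbit_map T (Suc j) = T j \<circ> orbit_map T j"

text \<open>Only meaningful for \<open>n \<ge> 1\<close>, as is everything below that depends on it; all the pressures are
  limits in which \<open>n = 0\<close> plays no role.\<close>

definition bowen_dist ::
    "(nat \<Rightarrow> 'a metric) \<Rightarrow> (nat \<Rightarrow> 'a \<Rightarrow> 'a) \<Rightarrow> nat \<Rightarrow> 'a \<Rightarrow> 'a \<Rightarrow> real" where
  "bowen_dist X T n x y = (MAX j\<in>{0..<n}. mdist (X j) (orbit_map T j x) (orbit_map T j y))"

definition bowen_ball ::
    "(nat \<Rightarrow> 'a metric) \<Rightarrow> (nat \<Rightarrow> 'a \<Rightarrow> 'a) \<Rightarrow> nat \<Rightarrow> 'a \<Rightarrow> real \<Rightarrow> 'a set" where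
  "bowen_ball X T n x \<epsilon> = {y \<in> mspace (X 0). bowen_dist X T n x y < \<epsilon>}"

definition bowen_cball ::
    "(nat \<Rightarrow> 'a metric) \<Rightarrow> (nat \<Rightarrow> 'a \<Rightarrow> 'a) \<Rightarrow> nat \<Rightarrow> 'a \<Rightarrow> real \<Rightarrow> 'a set" where
  "bowen_cball X T n x \<epsilon> = {y \<in> mspace (X 0). bowen_dist X T n x y \<le> \<epsilon>}"

definition potentials :: "(nat \<Rightarrow> 'a metric) \<Rightarrow> (nat \<Rightarrow> 'a \<Rightarrow> real) set" where
  "potentials X = {f. \<forall>k. continuous_map (mtopology_of (X k)) euclideanreal (f k)}"

definition birkhoff_sum ::
    "(nat \<Rightarrow> 'a \<Rightarrow> 'a) \<Rightarrow> (nat \<Rightarrow> 'a \<Rightarrow> real) \<Rightarrow> nat \<Rightarrow> 'a \<Rightarrow> real" where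
  "birkhoff_sum T f n x = (\<Sum>j<n. f j (orbit_map T j x))"

definition equicontinuous_maps ::
    "(nat \<Rightarrow> 'a metric) \<Rightarrow> (nat \<Rightarrow> 'b metric) \<Rightarrow> (nat \<Rightarrow> 'a \<Rightarrow> 'b) \<Rightarrow> bool" where
  "equicontinuous_maps X Y h \<longleftrightarrow>
     (\<forall>\<epsilon>>0. \<exists>\<delta>>0. \<forall>k. \<forall>x\<in>mspace (X k). \<forall>y\<in>mspace (X k).
        mdist (X k) x y < \<delta> \<longrightarrow> mdist (Y k) (h k x) (h k y) < \<epsilon>)"

definition equicontinuous_potential ::
    "(nat \<Rightarrow> 'a metric) \<Rightarrow> (nat \<Rightarrow> 'a \<Rightarrow> real) \<Rightarrow> bool" where
  "equicontinuous_potential X f \<longleftrightarrow>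
     (\<forall>\<epsilon>>0. \<exists>\<delta>>0. \<forall>k. \<forall>x\<in>mspace (X k). \<forall>y\<in>mspace (X k).
        mdist (X k) x y < \<delta> \<longrightarrow> \<bar>f k x - f k y\<bar> < \<epsilon>)"


subsection \<open>Conjugacies\<close>

definition semiconjugacy ::
    "(nat \<Rightarrow> 'a metric) \<Rightarrow> (nat \<Rightarrow> 'a \<Rightarrow> 'a) \<Rightarrow> (nat \<Rightarrow> 'b metric) \<Rightarrow> (nat \<Rightarrow> 'b \<Rightarrow> 'b) \<Rightarrow>
     (nat \<Rightarrow> 'a \<Rightarrow> 'b) \<Rightarrow> bool" where
  "semiconjugacy X T Y R \<pi> \<longleftrightarrow>
     (\<forall>k. continuous_map (mtopology_of (X k)) (mtopology_of (Y k)) (\<pi> k)) \<and>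
     (\<forall>k. \<pi> k ` mspace (X k) = mspace (Y k)) \<and>
     (\<forall>k. \<forall>x\<in>mspace (X k). R k (\<pi> k x) = \<pi> (Suc k) (T k x))"

definition conjugacy ::
    "(nat \<Rightarrow> 'a metric) \<Rightarrow> (nat \<Rightarrow> 'a \<Rightarrow> 'a) \<Rightarrow> (nat \<Rightarrow> 'b metric) \<Rightarrow> (nat \<Rightarrow> 'b \<Rightarrow> 'b) \<Rightarrow>
     (nat \<Rightarrow> 'a \<Rightarrow> 'b) \<Rightarrow> bool" where
  "conjugacy X T Y R \<pi> \<longleftrightarrow>
     semiconjugacy X T Y R \<pi> \<and>
     (\<forall>k. homeomorphic_map (mtopology_of (X k)) (mtopology_of (Y k)) (\<pi> k))"

definition equisemiconjugacy ::
    "(nat \<Rightarrow> 'a metric) \<Rightarrow> (nat \<Rightarrow> 'a \<Rightarrow> 'a) \<Rightarrow> (nat \<Rightarrow> 'b metric) \<Rightarrow> (nat \<Rightarrow> 'b \<Rightarrow> 'b) \<Rightarrow>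
     (nat \<Rightarrow> 'a \<Rightarrow> 'b) \<Rightarrow> bool" where
  "equisemiconjugacy X T Y R \<pi> \<longleftrightarrow>
     semiconjugacy X T Y R \<pi> \<and> equicontinuous_maps X Y \<pi>"

definition equiconjugacy ::
    "(nat \<Rightarrow> 'a metric) \<Rightarrow> (nat \<Rightarrow> 'a \<Rightarrow> 'a) \<Rightarrow> (nat \<Rightarrow> 'b metric) \<Rightarrow> (nat \<Rightarrow> 'b \<Rightarrow> 'b) \<Rightarrow>
     (nat \<Rightarrow> 'a \<Rightarrow> 'b) \<Rightarrow> bool" where
  "equiconjugacy X T Y R \<pi> \<longleftrightarrow>
     conjugacy X T Y R \<pi> \<and> equicontinuous_maps X Y \<pi> \<and>
     equicontinuous_maps Y X (\<lambda>k. inv_into (mspace (X k)) (\<pi> k))"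

definition pullback :: "(nat \<Rightarrow> 'a \<Rightarrow> 'b) \<Rightarrow> (nat \<Rightarrow> 'b \<Rightarrow> real) \<Rightarrow> nat \<Rightarrow> 'a \<Rightarrow> real" where
  "pullback \<pi> g = (\<lambda>k. g k \<circ> \<pi> k)"


subsection \<open>Spanning and separated pressures\<close>

definition ln_ennreal :: "ennreal \<Rightarrow> ereal" where
  "ln_ennreal a = (if a = 0 then -\<infinity> else if a = \<infinity> then \<infinity> else ereal (ln (enn2real a)))"

definition spanning ::
    "(nat \<Rightarrow> 'a metric) \<Rightarrow> (nat \<Rightarrow> 'a \<Rightarrow> 'a) \<Rightarrow> 'a set \<Rightarrow> nat \<Rightarrow> real \<Rightarrow> 'a set \<Rightarrow> bool" where
  "spanning X T Z n \<epsilon> F \<longleftrightarrow> F \<subseteq> mspace (X 0) \<and> (\<forall>x\<in>Z. \<exists>y\<in>F. bowen_dist X T n x y \<le> \<epsilon>)"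

definition separated ::
    "(nat \<Rightarrow> 'a metric) \<Rightarrow> (nat \<Rightarrow> 'a \<Rightarrow> 'a) \<Rightarrow> 'a set \<Rightarrow> nat \<Rightarrow> real \<Rightarrow> 'a set \<Rightarrow> bool" where
  "separated X T Z n \<epsilon> E \<longleftrightarrow> E \<subseteq> Z \<and> (\<forall>x\<in>E. \<forall>y\<in>E. x \<noteq> y \<longrightarrow> bowen_dist X T n x y > \<epsilon>)"

definition span_sum ::
    "(nat \<Rightarrow> 'a metric) \<Rightarrow> (nat \<Rightarrow> 'a \<Rightarrow> 'a) \<Rightarrow> (nat \<Rightarrow> 'a \<Rightarrow> real) \<Rightarrow> 'a set \<Rightarrow> real \<Rightarrow> nat \<Rightarrow>
     ennreal" where
  "span_sum X T f Z \<epsilon> n =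
     (INF F\<in>{F. spanning X T Z n \<epsilon> F}. \<Sum>\<^sub>\<infinity>x\<in>F. ennreal (exp (birkhoff_sum T f n x)))"

definition sep_sum ::
    "(nat \<Rightarrow> 'a metric) \<Rightarrow> (nat \<Rightarrow> 'a \<Rightarrow> 'a) \<Rightarrow> (nat \<Rightarrow> 'a \<Rightarrow> real) \<Rightarrow> 'a set \<Rightarrow> real \<Rightarrow> nat \<Rightarrow>
     ennreal" where
  "sep_sum X T f Z \<epsilon> n =
     (SUP E\<in>{E. separated X T Z n \<epsilon> E}. \<Sum>\<^sub>\<infinity>x\<in>E. ennreal (exp (birkhoff_sum T f n x)))"


subsection \<open>Bowen and packing pressures\<close>

text \<open>Countable families, finite and empty ones included, are indexed by a set \<open>I\<close> of natural
  numbers.\<close>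

definition bowen_premeasure ::
    "(nat \<Rightarrow> 'a metric) \<Rightarrow> (nat \<Rightarrow> 'a \<Rightarrow> 'a) \<Rightarrow> (nat \<Rightarrow> 'a \<Rightarrow> real) \<Rightarrow> 'a set \<Rightarrow> real \<Rightarrow> real \<Rightarrow>
     nat \<Rightarrow> ennreal" where
  "bowen_premeasure X T f Z \<epsilon> s N =
     Inf {\<Sum>\<^sub>\<infinity>i\<in>I. ennreal (exp (- real (n i) * s + birkhoff_sum T f (n i) (x i))) |
          (I :: nat set) n x.
          (\<forall>i\<in>I. n i \<ge> N \<and> x i \<in> mspace (X 0)) \<and>
          Z \<subseteq> (\<Union>i\<in>I. bowen_ball X T (n i) (x i) \<epsilon>)}"

definition bowen_measure ::
    "(nat \<Rightarrow> 'a metric) \<Rightarrow> (nat \<Rightarrow> 'a \<Rightarrow> 'a) \<Rightarrow> (nat \<Rightarrow> 'a \<Rightarrow> real) \<Rightarrow> 'a set \<Rightarrow> real \<Rightarrow> real \<Rightarrow>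
     ennreal" where
  "bowen_measure X T f Z \<epsilon> s = lim (\<lambda>N. bowen_premeasure X T f Z \<epsilon> s N)"

definition packing_premeasure ::
    "(nat \<Rightarrow> 'a metric) \<Rightarrow> (nat \<Rightarrow> 'a \<Rightarrow> 'a) \<Rightarrow> (nat \<Rightarrow> 'a \<Rightarrow> real) \<Rightarrow> 'a set \<Rightarrow> real \<Rightarrow> real \<Rightarrow>
     nat \<Rightarrow> ennreal" where
  "packing_premeasure X T f Z \<epsilon> s N =
     Sup {\<Sum>\<^sub>\<infinity>i\<in>I. ennreal (exp (- real (n i) * s + birkhoff_sum T f (n i) (x i))) |
          (I :: nat set) n x.
          (\<forall>i\<in>I. n i \<ge> N \<and> x i \<in> Z) \<and>
          disjoint_family_on (\<lambda>i. bowen_cball X T (n i) (x i) \<epsilon>) I}"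

definition packing_premeasure_lim ::
    "(nat \<Rightarrow> 'a metric) \<Rightarrow> (nat \<Rightarrow> 'a \<Rightarrow> 'a) \<Rightarrow> (nat \<Rightarrow> 'a \<Rightarrow> real) \<Rightarrow> 'a set \<Rightarrow> real \<Rightarrow> real \<Rightarrow>
     ennreal" where
  "packing_premeasure_lim X T f Z \<epsilon> s = lim (\<lambda>N. packing_premeasure X T f Z \<epsilon> s N)"

definition packing_measure ::
    "(nat \<Rightarrow> 'a metric) \<Rightarrow> (nat \<Rightarrow> 'a \<Rightarrow> 'a) \<Rightarrow> (nat \<Rightarrow> 'a \<Rightarrow> real) \<Rightarrow> 'a set \<Rightarrow> real \<Rightarrow> real \<Rightarrow>
     ennreal" where
  "packing_measure X T f Z \<epsilon> s =
     Inf {\<Sum>i. packing_premeasure_lim X T f (W i) \<epsilon> s | W :: nat \<Rightarrow> 'a set.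
          (\<forall>i. W i \<subseteq> mspace (X 0)) \<and> Z \<subseteq> (\<Union>i. W i)}"


subsection \<open>The six pressures\<close>

text \<open>A pressure is compared on systems with different carrier types, so the choice among the six
  is a datatype rather than a variable ranging over functionals.\<close>

datatype pressure_kind =
    Lower_Spanning | Upper_Spanning | Lower_Separated | Upper_Separated | Bowen | Packing

text \<open>For the Bowen and packing pressures the infimum below (which is \<open>\<infinity>\<close> for the empty set)
  coincides with the supremum of the \<open>s\<close> at which the measure is infinite.\<close>

primrec pressure_at ::
    "pressure_kind \<Rightarrow> (nat \<Rightarrow> 'a metric) \<Rightarrow> (nat \<Rightarrow> 'a \<Rightarrow> 'a) \<Rightarrow> (nat \<Rightarrow> 'a \<Rightarrow> real) \<Rightarrow> 'a set \<Rightarrow>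
     real \<Rightarrow> ereal" where
  "pressure_at Lower_Spanning X T f Z \<epsilon> =
     liminf (\<lambda>n. ereal (1 / real n) * ln_ennreal (span_sum X T f Z \<epsilon> n))"
| "pressure_at Upper_Spanning X T f Z \<epsilon> =
     limsup (\<lambda>n. ereal (1 / real n) * ln_ennreal (span_sum X T f Z \<epsilon> n))"
| "pressure_at Lower_Separated X T f Z \<epsilon> =
     liminf (\<lambda>n. ereal (1 / real n) * ln_ennreal (sep_sum X T f Z \<epsilon> n))"
| "pressure_at Upper_Separated X T f Z \<epsilon> =
     limsup (\<lambda>n. ereal (1 / real n) * ln_ennreal (sep_sum X T f Z \<epsilon> n))"
| "pressure_at Bowen X T f Z \<epsilon> =
     Inf {ereal s | s. bowen_measure X T f Z \<epsilon> s = 0}"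
| "pressure_at Packing X T f Z \<epsilon> =
     Inf {ereal s | s. packing_measure X T f Z \<epsilon> s = 0}"

definition pressure ::
    "pressure_kind \<Rightarrow> (nat \<Rightarrow> 'a metric) \<Rightarrow> (nat \<Rightarrow> 'a \<Rightarrow> 'a) \<Rightarrow> (nat \<Rightarrow> 'a \<Rightarrow> real) \<Rightarrow> 'a set \<Rightarrow>
     ereal" where
  "pressure P X T f Z = Lim (at_right 0) (\<lambda>\<epsilon>. pressure_at P X T f Z \<epsilon>)"

end

theory Submission
  imports Defs
begin

text \<open>
  If \<open>d(x, y) \<le> \<delta>\<close> forces \<open>d(\<pi> x, \<pi> y) < \<epsilon>\<close> in all spaces, then \<open>\<pi>\<close> carries
  spanning sets and covers at scale \<open>\<delta>\<close> to ones at scale \<open>\<epsilon>\<close>, and preimages carry separated sets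
  and packings at scale \<open>\<epsilon>\<close> back to ones at scale \<open>\<delta>\<close>, while Birkhoff sums are preserved.  So each
  pressure at scale \<open>\<epsilon>\<close> downstairs is at most the one at scale \<open>\<delta>\<close> upstairs.  Applied to the
  identity map this says that pressures are antitone in the scale, so that the limit as \<open>\<epsilon> \<rightarrow> 0\<close> is
  a supremum over \<open>\<epsilon> > 0\<close> and the comparison survives it.  Part (2) is part (1) for \<open>\<pi>\<close> and its
  inverse.
\<close>

section \<open>Logarithms, sums over images and one-sided limits\<close>

lemma ln_ennreal_mono: "a \<le> b \<Longrightarrow> ln_ennreal a \<le> ln_ennreal b"
  by (cases a; cases b) (auto simp: ln_ennreal_def top_unique)

text \<open>Keep one preimage \<open>G\<close> of each image point: reindexing along the injective
  restriction is exact, and the discarded terms are nonnegative.\<close>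

lemma infsum_image_le_ennreal:
  fixes h :: "'b \<Rightarrow> ennreal"
  shows "(\<Sum>\<^sub>\<infinity>y\<in>p ` F. h y) \<le> (\<Sum>\<^sub>\<infinity>x\<in>F. h (p x))"
proof -
  obtain G where G: "G \<subseteq> F" "inj_on p G" "p ` F = p ` G"
    using subset_image_inj[of "p ` F" p F] by auto
  have "(\<Sum>\<^sub>\<infinity>y\<in>p ` F. h y) = (\<Sum>\<^sub>\<infinity>x\<in>G. h (p x))"
    using G infsum_reindex[of p G h] by (simp add: o_def)
  also have "\<dots> \<le> (\<Sum>\<^sub>\<infinity>x\<in>F. h (p x))"
    using G by (intro infsum_mono_neutral) (auto intro: nonneg_summable_on_complete)
  finally show ?thesis .
qed

text \<open>A value above \<open>c\<close> at one scale persists at all smaller scales, and no value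
  exceeds the supremum.\<close>

lemma tendsto_at_right_SUP:
  fixes \<phi> :: "real \<Rightarrow> ereal"
  assumes anti: "\<And>\<delta> \<epsilon>. \<lbrakk>a < \<delta>; \<delta> < \<epsilon>\<rbrakk> \<Longrightarrow> \<phi> \<epsilon> \<le> \<phi> \<delta>"
  shows "(\<phi> \<longlongrightarrow> (SUP \<epsilon>\<in>{a<..}. \<phi> \<epsilon>)) (at_right a)"
proof (rule order_tendstoI)
  fix c assume "c < (SUP \<epsilon>\<in>{a<..}. \<phi> \<epsilon>)"
  then obtain \<epsilon> where "a < \<epsilon>" "c < \<phi> \<epsilon>"
    by (auto simp: less_SUP_iff)
  then show "eventually (\<lambda>\<delta>. c < \<phi> \<delta>) (at_right a)"
    using anti by (auto simp: eventually_at_right intro!: exI[of _ \<epsilon>] intro: less_le_trans)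
next
  fix c assume c: "(SUP \<epsilon>\<in>{a<..}. \<phi> \<epsilon>) < c"
  have "\<phi> \<epsilon> < c" if "a < \<epsilon>" for \<epsilon>
    using that c by (meson SUP_upper greaterThan_iff le_less_trans)
  then show "eventually (\<lambda>\<delta>. \<phi> \<delta> < c) (at_right a)"
    by (rule eventually_mono[OF eventually_at_right_less])
qed

section \<open>Invariance of the carriers and convergence of the premeasures in
  \<open>N\<close>\<close>

lemma nds_in_mspace: "\<lbrakk>nds X T; x \<in> mspace (X k)\<rbrakk> \<Longrightarrow> T k x \<in> mspace (X (Suc k))"
  unfolding nds_def continuous_map_def by auto

text \<open>\<open>lim\<close> carries information only if the limit exists. It does: raising
  \<open>N\<close> leaves fewer admissible covers, so the infimum grows.\<close>

lemma LIMSEQ_bowen_measure: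
  "(\<lambda>N. bowen_premeasure X T f Z \<epsilon> s N) \<longlonglongrightarrow> bowen_measure X T f Z \<epsilon> s"
proof -
  have "incseq (\<lambda>N. bowen_premeasure X T f Z \<epsilon> s N)"
    unfolding bowen_premeasure_def by (intro monoI Inf_superset_mono Collect_mono impI) (elim ex_forward, auto)
  then show ?thesis
    unfolding bowen_measure_def by (metis LIMSEQ_SUP limI)
qed

text \<open>Dually, raising \<open>N\<close> leaves fewer packings, so the supremum shrinks.\<close>

lemma LIMSEQ_packing_premeasure_lim:
  "(\<lambda>N. packing_premeasure X T f Z \<epsilon> s N) \<longlonglongrightarrow> packing_premeasure_lim X T f Z \<epsilon> s"
proof -
  have "decseq (\<lambda>N. packing_premeasure X T f Z \<epsilon> s N)"
    unfolding packing_premeasure_def by (intro antimonoI Sup_subset_mono Collect_mono impI) (elim ex_forward, auto)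
  then show ?thesis
    unfolding packing_premeasure_lim_def by (metis LIMSEQ_INF limI)
qed

text \<open>The potential \<open>f\<close> only has to agree with the pullback of \<open>g\<close> on the carriers: for the inverse
  of a conjugacy the two differ elsewhere.\<close>

locale nds_factor =
  fixes X :: "nat \<Rightarrow> 'a metric" and T :: "nat \<Rightarrow> 'a \<Rightarrow> 'a" and f :: "nat \<Rightarrow> 'a \<Rightarrow> real"
    and Y :: "nat \<Rightarrow> 'b metric" and R :: "nat \<Rightarrow> 'b \<Rightarrow> 'b" and g :: "nat \<Rightarrow> 'b \<Rightarrow> real"
    and \<pi> :: "nat \<Rightarrow> 'a \<Rightarrow> 'b"
  assumes T_in: "x \<in> mspace (X k) \<Longrightarrow> T k x \<in> mspace (X (Suc k))"
    and pi_in: "x \<in> mspace (X k) \<Longrightarrow> \<pi> k x \<in> mspace (Y k)"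
    and commute: "x \<in> mspace (X k) \<Longrightarrow> R k (\<pi> k x) = \<pi> (Suc k) (T k x)"
    and potential: "x \<in> mspace (X k) \<Longrightarrow> f k x = g k (\<pi> k x)"
begin

section \<open>Orbits and weights along a factor map, then comparison at two fixed scales\<close>

lemma orbit_in: "x \<in> mspace (X 0) \<Longrightarrow> orbit_map T j x \<in> mspace (X j)"
  by (induction j) (auto intro: T_in)

lemma orbit_pi: "x \<in> mspace (X 0) \<Longrightarrow> orbit_map R j (\<pi> 0 x) = \<pi> j (orbit_map T j x)"
  by (induction j) (auto simp: commute orbit_in)

lemma birkhoff_sum_pi:
  "x \<in> mspace (X 0) \<Longrightarrow> birkhoff_sum R g n (\<pi> 0 x) = birkhoff_sum T f n x"
  unfolding birkhoff_sum_def by (auto simp: orbit_pi potential orbit_in)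

text \<open>Nonstrict upstairs and strict downstairs: this one condition serves open and closed
  balls, spanning and separated sets alike. For the identity map it follows from \<delta> <
  \<epsilon>.\<close>

context
  fixes \<delta> \<epsilon> :: real
  assumes scale: "\<lbrakk>x \<in> mspace (X k); y \<in> mspace (X k); mdist (X k) x y \<le> \<delta>\<rbrakk>
    \<Longrightarrow> mdist (Y k) (\<pi> k x) (\<pi> k y) < \<epsilon>"
begin

text \<open>For \<open>0 < n\<close> the maximum runs over a nonempty finite set, so the strict
  bounds at each time give a strict bound on it. This is the source of the positivity conditions
  below.\<close>

lemma bowen_dist_pi:
  assumes "0 < n" "x \<in> mspace (X 0)" "y \<in> mspace (X 0)" "bowen_dist X T n x y \<le> \<delta>"
  shows "bowen_dist Y R n (\<pi> 0 x) (\<pi> 0 y) < \<epsilon>"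
  using assms unfolding bowen_dist_def by (auto simp: orbit_pi orbit_in intro!: scale)

lemma span_sum_pi:
  assumes "0 < n" "Z \<subseteq> mspace (X 0)"
  shows "span_sum Y R g (\<pi> 0 ` Z) \<epsilon> n \<le> span_sum X T f Z \<delta> n"
  unfolding span_sum_def
proof (rule INF_mono)
  fix F assume "F \<in> {F. spanning X T Z n \<delta> F}"
  then have F: "F \<subseteq> mspace (X 0)" "\<forall>x\<in>Z. \<exists>y\<in>F. bowen_dist X T n x y \<le> \<delta>"
    by (auto simp: spanning_def)
  have "spanning Y R (\<pi> 0 ` Z) n \<epsilon> (\<pi> 0 ` F)"
    unfolding spanning_def
  proof (intro conjI ballI)
    show "\<pi> 0 ` F \<subseteq> mspace (Y 0)"
      using F by (auto intro: pi_in)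
    fix z assume "z \<in> \<pi> 0 ` Z"
    then obtain x where x: "x \<in> Z" "z = \<pi> 0 x" by blast
    then obtain y where "y \<in> F" "bowen_dist X T n x y \<le> \<delta>"
      using F by blast
    then show "\<exists>y\<in>\<pi> 0 ` F. bowen_dist Y R n z y \<le> \<epsilon>"
      using bowen_dist_pi[of n x y] x F assms by (auto intro: less_imp_le)
  qed
  \<comment> \<open>Points of \<open>F\<close> with a common image are counted only once downstairs,
    hence an inequality.\<close>
  moreover have "(\<Sum>\<^sub>\<infinity>y\<in>\<pi> 0 ` F. ennreal (exp (birkhoff_sum R g n y)))
      \<le> (\<Sum>\<^sub>\<infinity>x\<in>F. ennreal (exp (birkhoff_sum T f n x)))"
  proof -
    have "(\<Sum>\<^sub>\<infinity>x\<in>F. ennreal (exp (birkhoff_sum R g n (\<pi> 0 x))))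
        = (\<Sum>\<^sub>\<infinity>x\<in>F. ennreal (exp (birkhoff_sum T f n x)))"
      using F by (intro infsum_cong) (auto simp: birkhoff_sum_pi)
    then show ?thesis
      using infsum_image_le_ennreal[of "\<lambda>y. ennreal (exp (birkhoff_sum R g n y))" "\<pi> 0" F] by simp
  qed
  ultimately show "\<exists>G\<in>{F. spanning Y R (\<pi> 0 ` Z) n \<epsilon> F}.
      (\<Sum>\<^sub>\<infinity>y\<in>G. ennreal (exp (birkhoff_sum R g n y)))
        \<le> (\<Sum>\<^sub>\<infinity>x\<in>F. ennreal (exp (birkhoff_sum T f n x)))"
    by blast
qed

lemma sep_sum_pi:
  assumes "0 < n" "Z \<subseteq> mspace (X 0)"
  shows "sep_sum Y R g (\<pi> 0 ` Z) \<epsilon> n \<le> sep_sum X T f Z \<delta> n"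
  unfolding sep_sum_def
proof (rule SUP_mono)
  fix E assume "E \<in> {E. separated Y R (\<pi> 0 ` Z) n \<epsilon> E}"
  then have E: "E \<subseteq> \<pi> 0 ` Z" "\<forall>x\<in>E. \<forall>y\<in>E. x \<noteq> y \<longrightarrow> bowen_dist Y R n x y > \<epsilon>"
    by (auto simp: separated_def)
  \<comment> \<open>\<open>D\<close> takes exactly one preimage in \<open>Z\<close> per point of
    \<open>E\<close>, so here the two sums are equal.\<close>
  obtain D where D: "D \<subseteq> Z" "inj_on (\<pi> 0) D" "E = \<pi> 0 ` D"
    using E subset_image_inj[of E "\<pi> 0" Z] by auto
  have "separated X T Z n \<delta> D"
    unfolding separated_def
  proof (intro conjI ballI impI)
    fix x y assume xy: "x \<in> D" "y \<in> D" "x \<noteq> y"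
    then have "\<pi> 0 x \<noteq> \<pi> 0 y"
      using D by (auto dest: inj_onD)
    then have "\<epsilon> < bowen_dist Y R n (\<pi> 0 x) (\<pi> 0 y)"
      using E D xy by blast
    then show "\<delta> < bowen_dist X T n x y"
      using bowen_dist_pi[of n x y] xy D assms by force
  qed (use D in auto)
  moreover have "(\<Sum>\<^sub>\<infinity>x\<in>E. ennreal (exp (birkhoff_sum R g n x)))
      = (\<Sum>\<^sub>\<infinity>x\<in>D. ennreal (exp (birkhoff_sum R g n (\<pi> 0 x))))"
    using D infsum_reindex[of "\<pi> 0" D "\<lambda>x. ennreal (exp (birkhoff_sum R g n x))"]
    by (simp add: o_def)
  moreover have "\<dots> = (\<Sum>\<^sub>\<infinity>x\<in>D. ennreal (exp (birkhoff_sum T f n x)))"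
    using D assms by (intro infsum_cong) (auto simp: birkhoff_sum_pi subset_iff)
  ultimately show "\<exists>D\<in>{E. separated X T Z n \<delta> E}.
      (\<Sum>\<^sub>\<infinity>x\<in>E. ennreal (exp (birkhoff_sum R g n x)))
        \<le> (\<Sum>\<^sub>\<infinity>x\<in>D. ennreal (exp (birkhoff_sum T f n x)))"
    by auto
qed

lemma bowen_premeasure_pi:
  assumes "0 < N" "Z \<subseteq> mspace (X 0)"
  shows "bowen_premeasure Y R g (\<pi> 0 ` Z) \<epsilon> s N \<le> bowen_premeasure X T f Z \<delta> s N"
  unfolding bowen_premeasure_def
proof (rule Inf_mono, safe)
  fix I :: "nat set" and n x
  assume n: "\<forall>i\<in>I. N \<le> n i \<and> x i \<in> mspace (X 0)"
    and cover: "Z \<subseteq> (\<Union>i\<in>I. bowen_ball X T (n i) (x i) \<delta>)"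
  \<comment> \<open>Same indices and times, centres moved by \<open>\<pi> 0\<close>. Since sums run
    over indices, coinciding centres lose no terms.\<close>
  have "\<pi> 0 ` Z \<subseteq> (\<Union>i\<in>I. bowen_ball Y R (n i) (\<pi> 0 (x i)) \<epsilon>)"
  proof safe
    fix z assume "z \<in> Z"
    then obtain i where i: "i \<in> I" "z \<in> mspace (X 0)" "bowen_dist X T (n i) (x i) z < \<delta>"
      using cover by (auto simp: bowen_ball_def)
    then show "\<pi> 0 z \<in> (\<Union>i\<in>I. bowen_ball Y R (n i) (\<pi> 0 (x i)) \<epsilon>)"
      using n \<open>0 < N\<close>
      by (auto simp: bowen_ball_def pi_in intro!: bexI[of _ i] bowen_dist_pi)
  qed
  moreover have "(\<Sum>\<^sub>\<infinity>i\<in>I. ennreal (exp (- real (n i) * s + birkhoff_sum T f (n i) (x i))))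
      = (\<Sum>\<^sub>\<infinity>i\<in>I. ennreal (exp (- real (n i) * s + birkhoff_sum R g (n i) (\<pi> 0 (x i)))))"
    using n by (intro infsum_cong) (auto simp: birkhoff_sum_pi)
  ultimately show "\<exists>a\<in>{\<Sum>\<^sub>\<infinity>i\<in>I. ennreal (exp (- real (n i) * s + birkhoff_sum R g (n i) (x i))) |
        (I :: nat set) n x. (\<forall>i\<in>I. N \<le> n i \<and> x i \<in> mspace (Y 0)) \<and>
          \<pi> 0 ` Z \<subseteq> (\<Union>i\<in>I. bowen_ball Y R (n i) (x i) \<epsilon>)}.
      a \<le> (\<Sum>\<^sub>\<infinity>i\<in>I. ennreal (exp (- real (n i) * s + birkhoff_sum T f (n i) (x i))))"
    using n pi_in
    by (intro bexI[of "\<lambda>a. a \<le> _", OF order_refl] CollectI exI[of _ I] exI[of _ n] exI[of _ "\<lambda>i. \<pi> 0 (x i)"]) auto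
qed

lemma bowen_measure_pi:
  assumes "Z \<subseteq> mspace (X 0)"
  shows "bowen_measure Y R g (\<pi> 0 ` Z) \<epsilon> s \<le> bowen_measure X T f Z \<delta> s"
  using assms
  \<comment> \<open>Starting at \<open>N = 1\<close> excludes balls of time 0.\<close>
  by (intro LIMSEQ_le[OF LIMSEQ_bowen_measure LIMSEQ_bowen_measure] exI[of _ 1] allI impI
      bowen_premeasure_pi) auto

lemma packing_premeasure_pi:
  assumes "0 < N" "Z \<subseteq> mspace (X 0)"
  shows "packing_premeasure Y R g (\<pi> 0 ` Z) \<epsilon> s N \<le> packing_premeasure X T f Z \<delta> s N"
  unfolding packing_premeasure_def
proof (rule Sup_mono, safe)
  fix I :: "nat set" and n y
  assume n: "\<forall>i\<in>I. N \<le> n i \<and> y i \<in> \<pi> 0 ` Z"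
    and disj: "disjoint_family_on (\<lambda>i. bowen_cball Y R (n i) (y i) \<epsilon>) I"
  obtain x where x: "\<And>i. i \<in> I \<Longrightarrow> x i \<in> Z \<and> y i = \<pi> 0 (x i)"
    using n bchoice[of I "\<lambda>i z. z \<in> Z \<and> y i = \<pi> 0 z"] by (auto simp: image_iff Bex_def)
  \<comment> \<open>A common point of two balls upstairs would map to a common point of the
    corresponding balls downstairs, so disjointness pulls back.\<close>
  have into: "\<pi> 0 z \<in> bowen_cball Y R (n i) (y i) \<epsilon>"
    if "i \<in> I" "z \<in> bowen_cball X T (n i) (x i) \<delta>" for i z
  proof -
    have "0 < n i" "x i \<in> mspace (X 0)" "z \<in> mspace (X 0)" "bowen_dist X T (n i) (x i) z \<le> \<delta>"
      using that n x[OF that(1)] assms by (auto simp: bowen_cball_def)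
    then show ?thesis
      using x[OF that(1)] bowen_dist_pi[of "n i" "x i" z] by (simp add: bowen_cball_def pi_in)
  qed
  have "disjoint_family_on (\<lambda>i. bowen_cball X T (n i) (x i) \<delta>) I"
    using disj into unfolding disjoint_family_on_def by blast
  moreover have "(\<Sum>\<^sub>\<infinity>i\<in>I. ennreal (exp (- real (n i) * s + birkhoff_sum R g (n i) (y i))))
      = (\<Sum>\<^sub>\<infinity>i\<in>I. ennreal (exp (- real (n i) * s + birkhoff_sum T f (n i) (x i))))"
    using x assms by (intro infsum_cong) (auto simp: birkhoff_sum_pi subset_iff)
  ultimately show "\<exists>a\<in>{\<Sum>\<^sub>\<infinity>i\<in>I. ennreal (exp (- real (n i) * s + birkhoff_sum T f (n i) (x i))) |
        (I :: nat set) n x. (\<forall>i\<in>I. N \<le> n i \<and> x i \<in> Z) \<and>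
          disjoint_family_on (\<lambda>i. bowen_cball X T (n i) (x i) \<delta>) I}.
      (\<Sum>\<^sub>\<infinity>i\<in>I. ennreal (exp (- real (n i) * s + birkhoff_sum R g (n i) (y i)))) \<le> a"
    using n x
    by (intro bexI[of "\<lambda>a. _ \<le> a", OF order_refl] CollectI exI[of _ I] exI[of _ n] exI[of _ x]) auto
qed

lemma packing_measure_pi:
  assumes "Z \<subseteq> mspace (X 0)"
  shows "packing_measure Y R g (\<pi> 0 ` Z) \<epsilon> s \<le> packing_measure X T f Z \<delta> s"
  unfolding packing_measure_def
proof (rule Inf_mono, safe)
  fix W :: "nat \<Rightarrow> 'a set"
  assume W: "\<forall>i. W i \<subseteq> mspace (X 0)" "Z \<subseteq> (\<Union>i. W i)"
  \<comment> \<open>Two directions meet here: covers of \<open>Z\<close> are pushed forward because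
    of the outer infimum, while packings centred in each piece are pulled back.\<close>
  have "packing_premeasure_lim Y R g (\<pi> 0 ` W i) \<epsilon> s \<le> packing_premeasure_lim X T f (W i) \<delta> s" for i
    using W
    by (intro LIMSEQ_le[OF LIMSEQ_packing_premeasure_lim LIMSEQ_packing_premeasure_lim]
        exI[of _ 1] allI impI packing_premeasure_pi) auto
  then have "(\<Sum>i. packing_premeasure_lim Y R g (\<pi> 0 ` W i) \<epsilon> s)
      \<le> (\<Sum>i. packing_premeasure_lim X T f (W i) \<delta> s)"
    by (intro suminf_le) auto
  moreover have "\<forall>i. \<pi> 0 ` W i \<subseteq> mspace (Y 0)" "\<pi> 0 ` Z \<subseteq> (\<Union>i. \<pi> 0 ` W i)"
    using W by (auto intro!: pi_in) (metis UN_iff imageI subsetD)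
  ultimately show "\<exists>a\<in>{\<Sum>i. packing_premeasure_lim Y R g (W i) \<epsilon> s | W :: nat \<Rightarrow> 'b set.
      (\<forall>i. W i \<subseteq> mspace (Y 0)) \<and> \<pi> 0 ` Z \<subseteq> (\<Union>i. W i)}.
      a \<le> (\<Sum>i. packing_premeasure_lim X T f (W i) \<delta> s)"
    by (intro bexI CollectI exI[of _ "\<lambda>i. \<pi> 0 ` W i"]) auto
qed

lemma pressure_at_pi:
  assumes Z: "Z \<subseteq> mspace (X 0)"
  shows "pressure_at P Y R g (\<pi> 0 ` Z) \<epsilon> \<le> pressure_at P X T f Z \<delta>"
proof -
  have span: "\<forall>\<^sub>F n in sequentially.
      ereal (1 / real n) * ln_ennreal (span_sum Y R g (\<pi> 0 ` Z) \<epsilon> n)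
        \<le> ereal (1 / real n) * ln_ennreal (span_sum X T f Z \<delta> n)"
    using eventually_gt_at_top[of 0]
    by eventually_elim (intro ereal_mult_left_mono ln_ennreal_mono span_sum_pi Z, auto)
  have sep: "\<forall>\<^sub>F n in sequentially.
      ereal (1 / real n) * ln_ennreal (sep_sum Y R g (\<pi> 0 ` Z) \<epsilon> n)
        \<le> ereal (1 / real n) * ln_ennreal (sep_sum X T f Z \<delta> n)"
    using eventually_gt_at_top[of 0]
    by eventually_elim (intro ereal_mult_left_mono ln_ennreal_mono sep_sum_pi Z, auto)
  \<comment> \<open>A zero upstairs forces a zero downstairs, so the infimum downstairs is over a
    larger set of \<open>s\<close>.\<close>
  have bowen: "bowen_measure Y R g (\<pi> 0 ` Z) \<epsilon> s = 0" if "bowen_measure X T f Z \<delta> s = 0" for s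
    using bowen_measure_pi[OF Z, of s] that by simp
  have packing: "packing_measure Y R g (\<pi> 0 ` Z) \<epsilon> s = 0"
    if "packing_measure X T f Z \<delta> s = 0" for s
    using packing_measure_pi[OF Z, of s] that by simp
  show ?thesis
  proof (cases P)
    case Bowen
    then show ?thesis using bowen by (auto intro!: Inf_superset_mono)
  next
    case Packing
    then show ?thesis using packing by (auto intro!: Inf_superset_mono)
  qed (simp_all add: Liminf_mono Limsup_mono span sep)
qed

end

end

section \<open>Letting the scale tend to zero\<close>

lemma pressure_eq_SUP:
  assumes "nds X T" "Z \<subseteq> mspace (X 0)"
  shows "pressure P X T f Z = (SUP \<epsilon>\<in>{0<..}. pressure_at P X T f Z \<epsilon>)"
proof -
  \<comment> \<open>The identity as a factor map of the system onto itself compares two scales of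
    the same system.\<close>
  interpret nds_factor X T f X T f "\<lambda>_. id"
    by unfold_locales (auto intro: nds_in_mspace[OF assms(1)])
  have "pressure_at P X T f Z \<epsilon> \<le> pressure_at P X T f Z \<delta>" if "\<delta> < \<epsilon>" for \<delta> \<epsilon>
    using pressure_at_pi[of \<delta> \<epsilon> Z P] that assms(2) by simp
  then show ?thesis
    unfolding pressure_def by (intro tendsto_Lim tendsto_at_right_SUP) auto
qed

lemma (in nds_factor) pressure_pi:
  assumes "nds X T" "nds Y R" "equicontinuous_maps X Y \<pi>" and Z: "Z \<subseteq> mspace (X 0)"
  shows "pressure P Y R g (\<pi> 0 ` Z) \<le> pressure P X T f Z"
proof -
  have "\<pi> 0 ` Z \<subseteq> mspace (Y 0)"
    using Z by (auto intro!: pi_in)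
  moreover have "(SUP \<epsilon>\<in>{0<..}. pressure_at P Y R g (\<pi> 0 ` Z) \<epsilon>)
      \<le> (SUP \<delta>\<in>{0<..}. pressure_at P X T f Z \<delta>)"
  proof (rule SUP_mono)
    fix \<epsilon> :: real assume "\<epsilon> \<in> {0<..}"
    then obtain \<delta> where "\<delta> > 0" and \<delta>: "\<And>k x y. \<lbrakk>x \<in> mspace (X k); y \<in> mspace (X k);
        mdist (X k) x y < \<delta>\<rbrakk> \<Longrightarrow> mdist (Y k) (\<pi> k x) (\<pi> k y) < \<epsilon>"
      using assms(3) unfolding equicontinuous_maps_def by (metis greaterThan_iff)
    \<comment> \<open>Halving \<delta> turns the strict bound of equicontinuity into the nonstrict
      one that \<open>scale\<close> asks for.\<close>
    have "pressure_at P Y R g (\<pi> 0 ` Z) \<epsilon> \<le> pressure_at P X T f Z (\<delta> / 2)"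
      using \<open>\<delta> > 0\<close> by (intro pressure_at_pi Z \<delta>) auto
    then show "\<exists>\<delta>\<in>{0<..}. pressure_at P Y R g (\<pi> 0 ` Z) \<epsilon> \<le> pressure_at P X T f Z \<delta>"
      using \<open>\<delta> > 0\<close> by (intro bexI[of _ "\<delta> / 2"]) auto
  qed
  ultimately show ?thesis
    using assms by (simp add: pressure_eq_SUP)
qed

section \<open>Equisemiconjugacies and equiconjugacies\<close>

theorem theorem7p1:
  fixes X :: "nat \<Rightarrow> 'a metric" and T :: "nat \<Rightarrow> 'a \<Rightarrow> 'a"
    and Y :: "nat \<Rightarrow> 'b metric" and R :: "nat \<Rightarrow> 'b \<Rightarrow> 'b"
    and g :: "nat \<Rightarrow> 'b \<Rightarrow> real" and Z :: "'a set"
    and P :: pressure_kind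
  assumes "nds X T" and "nds Y R"
    and "g \<in> potentials Y" and "equicontinuous_potential Y g"
    and "Z \<subseteq> mspace (X 0)"
  shows "(\<forall>\<pi>. equisemiconjugacy X T Y R \<pi> \<longrightarrow>
            pressure P X T (pullback \<pi> g) Z \<ge> pressure P Y R g (\<pi> 0 ` Z)) \<and>
         (\<forall>\<pi>. equiconjugacy X T Y R \<pi> \<longrightarrow>
            pressure P X T (pullback \<pi> g) Z = pressure P Y R g (\<pi> 0 ` Z))"
proof (intro conjI allI impI)
  have ge: "pressure P Y R g (\<pi> 0 ` Z) \<le> pressure P X T (pullback \<pi> g) Z"
    if "semiconjugacy X T Y R \<pi>" "equicontinuous_maps X Y \<pi>" for \<pi>
  proof -
    interpret nds_factor X T "pullback \<pi> g" Y R g \<pi>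
      using that(1) nds_in_mspace[OF assms(1)]
      by unfold_locales (simp_all add: semiconjugacy_def pullback_def, metis imageI)
    show ?thesis
      using assms that by (intro pressure_pi)
  qed
  show "pressure P Y R g (\<pi> 0 ` Z) \<le> pressure P X T (pullback \<pi> g) Z"
    if "equisemiconjugacy X T Y R \<pi>" for \<pi>
    using that ge by (simp add: equisemiconjugacy_def)
  show "pressure P X T (pullback \<pi> g) Z = pressure P Y R g (\<pi> 0 ` Z)"
    if "equiconjugacy X T Y R \<pi>" for \<pi>
  proof (rule antisym)
    define \<rho> where "\<rho> = (\<lambda>k. inv_into (mspace (X k)) (\<pi> k))"
    have semi: "semiconjugacy X T Y R \<pi>" and equi: "equicontinuous_maps X Y \<pi>"
      and equi_inv: "equicontinuous_maps Y X \<rho>"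
      and homeo: "\<And>k. homeomorphic_map (mtopology_of (X k)) (mtopology_of (Y k)) (\<pi> k)"
      using that by (auto simp: equiconjugacy_def conjugacy_def \<rho>_def)
    have surj: "\<pi> k ` mspace (X k) = mspace (Y k)" for k
      using semi by (auto simp: semiconjugacy_def)
    have inj: "inj_on (\<pi> k) (mspace (X k))" for k
      using homeomorphic_imp_injective_map[OF homeo[of k]] by simp
    have rho_in: "\<rho> k y \<in> mspace (X k)" if "y \<in> mspace (Y k)" for k y
      using that inv_into_into[of y "\<pi> k" "mspace (X k)"] surj by (simp add: \<rho>_def)
    have pi_rho: "\<pi> k (\<rho> k y) = y" if "y \<in> mspace (Y k)" for k y
      using that f_inv_into_f[of y "\<pi> k" "mspace (X k)"] surj by (simp add: \<rho>_def)
    have rho_pi: "\<rho> k (\<pi> k x) = x" if "x \<in> mspace (X k)" for k x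
      using that inj by (simp add: \<rho>_def)
    interpret inverse: nds_factor Y R g X T "pullback \<pi> g" \<rho>
    proof unfold_locales
      fix k y assume y: "y \<in> mspace (Y k)"
      show "R k y \<in> mspace (Y (Suc k))"
        using nds_in_mspace[OF assms(2)] y .
      show "\<rho> k y \<in> mspace (X k)"
        using rho_in y .
      \<comment> \<open>Intertwining for \<open>\<pi>\<close> at the point
        \<open>\<rho> k y\<close>; applying \<open>\<rho> (Suc k)\<close> then gives intertwining
        for the inverse.\<close>
      have "R k y = \<pi> (Suc k) (T k (\<rho> k y))"
        using semi rho_in[OF y] pi_rho[OF y] by (metis semiconjugacy_def)
      then show "T k (\<rho> k y) = \<rho> (Suc k) (R k y)"
        using nds_in_mspace[OF assms(1) rho_in[OF y]] rho_pi by simp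
      show "g k y = pullback \<pi> g k (\<rho> k y)"
        using pi_rho[OF y] by (simp add: pullback_def)
    qed
    have "\<pi> 0 ` Z \<subseteq> mspace (Y 0)"
      using image_mono[OF assms(5), of "\<pi> 0"] surj by simp
    moreover have "\<rho> 0 ` \<pi> 0 ` Z = Z"
      using inv_into_image_cancel[OF inj assms(5)] by (simp add: \<rho>_def)
    ultimately show "pressure P X T (pullback \<pi> g) Z \<le> pressure P Y R g (\<pi> 0 ` Z)"
      using inverse.pressure_pi[OF assms(2,1) equi_inv, of "\<pi> 0 ` Z" P] by simp
    show "pressure P Y R g (\<pi> 0 ` Z) \<le> pressure P X T (pullback \<pi> g) Z"
      using ge semi equi .
  qed
qed

end
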